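(* Let $p>5$ be a prime, let $q$ be a power of $p$, let $a\in\mathbb{F}_q^*$, let $m$ be a non-negative integer with $m\not\equiv 0,1,2,3,4\pmod p$, and let $k,d$ be positive integers. The polynomial $\mathfrak{D}_{k,m}=D_{k,m}(X^d,a)-D_{k,m}(0,a)\in\mathbb{F}_q[X]$ is a Dembowski-Ostrom (DO) polynomial over $\mathbb{F}_q$ if and only if one of the following holds: (i) $k=1$ and $d=p^n(p^{\alpha}+1)$ for some non-negative integers $\alpha$ and $n$. (ii) $k=2$ and $d=p^n(p^{\alpha}+1)/2$ for some non-negative integers $\alpha$ and $n$.
   Context: $\mathbb{F}_q$ is the finite field with $q$ elements and $\mathbb{F}_q^*$ is its multiplicative group of nonzero elements. For integers $k\ge 1$ and $m\ge 0$ and $a\in\mathbb{F}_q$, the $k$-th Dickson polynomial of the $(m+1)$-th kind is $$D_{k,m}(X,a)=\sum_{i=0}^{\lfloor k/2\rfloor}\frac{k-mi}{k-i}\binom{k-i}{i}(-a)^iX^{k-2i}\in\mathbb{F}_q[X],$$ where each coefficient $\frac{k-mi}{k-i}\binom{k-i}{i}$ is an integer, interpreted modulo $p$. For a positive integer $d$, $\mathfrak{D}_{k,m}:=D_{k,m}(X^d,a)-D_{k,m}(0,a)$, i.e. $D_{k,m}(X^d,a)$ with its constant term removed; explicitly $\mathfrak{D}_{k,m}=\sum_{i=0}^{\lfloor (k-1)/2\rfloor}\frac{k-mi}{k-i}\binom{k-i}{i}(-a)^iX^{(k-2i)d}$. A Dembowski-Ostrom (DO) polynomial over $\mathbb{F}_q$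 ($q$ a power of $p$) is a polynomial in $\mathbb{F}_q[X]$ of the form $\sum_{i,j}a_{ij}X^{p^i+p^j}$ (finite sum over non-negative integers $i,j$, with $a_{ij}\in\mathbb{F}_q$). Polynomials are considered as formal polynomials, not reduced modulo $X^q-X$. *)

theory Defs
  imports "HOL-Library.Cardinality" "HOL-Computational_Algebra.Computational_Algebra"
begin

text \<open>The integer \<open>(k - m i) / (k - i) * ((k - i) choose i)\<close>. The product is formed before the
  (integer) division, which is exact for \<open>i < k\<close>, see \<open>dickson_coeff_exact\<close>.\<close>

definition dickson_coeff :: "nat \<Rightarrow> nat \<Rightarrow> nat \<Rightarrow> int" where
  "dickson_coeff k m i =
     ((int k - int m * int i) * int ((k - i) choose i)) div (int k - int i)"

lemma dickson_coeff_exact: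
  assumes "i < k"
  shows "of_int (dickson_coeff k m i) =
    (of_nat k - of_nat m * of_nat i) / (of_nat k - of_nat i) * (of_nat ((k - i) choose i) :: rat)"
proof -
  have "(k - i) dvd i * ((k - i) choose i)"
  proof (cases i)
    case (Suc j)
    then obtain n where n: "k - i = Suc n"
      using assms by (metis Suc_diff_Suc)
    show ?thesis
      unfolding n unfolding Suc by (metis Suc_times_binomial dvd_triv_left)
  qed simp
  hence "int (k - i) dvd int i * int ((k - i) choose i)"
    by (metis int_dvd_int_iff of_nat_mult)
  moreover have "int (k - i) = int k - int i"
    using assms by simp
  ultimately have dvd1: "(int k - int i) dvd int i * int ((k - i) choose i)"
    by simp
  have "(int k - int m * int i) * int ((k - i) choose i) =
      (int k - int i) * int ((k - i) choose i) + (1 - int m) * (int i * int ((k - i) choose i))"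
    by (simp add: algebra_simps)
  hence "(int k - int i) dvd (int k - int m * int i) * int ((k - i) choose i)"
    using dvd1 by simp
  hence "dickson_coeff k m i * (int k - int i) =
      (int k - int m * int i) * int ((k - i) choose i)"
    unfolding dickson_coeff_def by simp
  hence "(of_int (dickson_coeff k m i * (int k - int i)) :: rat) =
      of_int ((int k - int m * int i) * int ((k - i) choose i))"
    by simp
  moreover have "(of_nat k :: rat) - of_nat i \<noteq> 0"
    using assms by simp
  ultimately show ?thesis
    by (simp add: field_simps)
qed

text \<open>The \<open>k\<close>-th Dickson polynomial \<open>D\<^sub>k\<^sub>,\<^sub>m(X, a)\<close> of the \<open>(m+1)\<close>-th kind. Meaningful only for
  \<open>k > 0\<close>; then \<open>i < k\<close> for every summation index, so the coefficients are as intended.\<close>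

definition dickson_poly :: "nat \<Rightarrow> nat \<Rightarrow> 'a::field \<Rightarrow> 'a poly" where
  "dickson_poly k m a =
     (\<Sum>i = 0..k div 2. monom (of_int (dickson_coeff k m i) * (- a) ^ i) (k - 2 * i))"

text \<open>\<open>D\<^sub>k\<^sub>,\<^sub>m(X\<^sup>d, a) - D\<^sub>k\<^sub>,\<^sub>m(0, a)\<close>.\<close>

definition dickson_frak :: "nat \<Rightarrow> nat \<Rightarrow> nat \<Rightarrow> 'a::field \<Rightarrow> 'a poly" where
  "dickson_frak d k m a =
     pcompose (dickson_poly k m a) (monom 1 d) - [:poly (dickson_poly k m a) 0:]"

text \<open>Equality of formal polynomials: nothing is reduced modulo \<open>X\<^sup>q - X\<close>. The parameter \<open>p\<close> is
  meant to be the characteristic of the coefficient field.\<close>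

definition dembowski_ostrom :: "nat \<Rightarrow> 'a::field poly \<Rightarrow> bool" where
  "dembowski_ostrom p f \<longleftrightarrow>
     (\<exists>(S :: (nat \<times> nat) set) (c :: nat \<Rightarrow> nat \<Rightarrow> 'a).
        finite S \<and> f = (\<Sum>(i, j)\<in>S. monom (c i j) (p ^ i + p ^ j)))"

end

theory Submission
  imports Defs "HOL-Number_Theory.Cong"
begin

text \<open>
  Call a number of the form \<open>p\<^sup>i + p\<^sup>j\<close> admissible. Since polynomials are formal, a DO polynomial is
  one all of whose exponents are admissible, so the theorem is about the exponents \<open>(k - 2 i) d\<close>
  whose coefficient is nonzero modulo \<open>p\<close>. For \<open>k = 1\<close> and \<open>k = 2\<close> the polynomial is the monomial
  \<open>X\<^bsup>kd\<^esup>\<close>, and the claim only rewrites \<open>p\<^sup>i + p\<^sup>j\<close> as \<open>p\<^sup>n (p\<^sup>\<alpha> + 1)\<close>.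

  The obstruction for \<open>k \<ge> 3\<close> is that powers of \<open>p\<close> are \<open>1\<close> modulo \<open>p - 1\<close>, so admissible numbers
  are \<open>2\<close> modulo \<open>p - 1\<close>. If \<open>k d\<close> and \<open>(k - j) d\<close> are both admissible, then \<open>p - 1\<close> divides their
  difference \<open>j d\<close>, hence also \<open>k (j d) = j (k d)\<close>, which is congruent to \<open>2 j\<close>; so \<open>p - 1\<close> divides
  \<open>2 j\<close> (lemma \<open>pred_dvd_if_two_multiples_admissible\<close>). For a prime \<open>p > 5\<close> this is impossible both
  for \<open>j = 2\<close> and for \<open>j = 4\<close>.

  It remains to see that two such exponents always occur. The leading coefficient is \<open>1\<close>, and the
  next one is \<open>k - m\<close> up to a power of \<open>- a\<close>; if it is nonzero, take \<open>j = 2\<close>. Otherwise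
  \<open>k \<equiv> m (mod p)\<close>, and the coefficient after that is, up to a unit, \<open>(k - 2 m) (k - 3) / 2\<close>, which
  is congruent to \<open>- m (m - 3) / 2\<close>, and this is nonzero because \<open>m\<close> is neither \<open>0\<close> nor \<open>3\<close> modulo \<open>p\<close>;
  take \<open>j = 4\<close>. The cases \<open>k = 3\<close> and \<open>k = 4\<close>, in which the exponent \<open>(k - 4) d\<close> would be missing,
  cannot occur here, since \<open>k \<equiv> m\<close> and \<open>m\<close> is neither \<open>3\<close> nor \<open>4\<close> modulo \<open>p\<close>.
\<close>

lemma dembowski_ostrom_exponent:
  assumes "dembowski_ostrom p f" and "coeff f n \<noteq> 0"
  shows "\<exists>i j. n = p ^ i + p ^ j"
proof -
  obtain S :: "(nat \<times> nat) set" and c where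
    f: "f = (\<Sum>(i, j)\<in>S. monom (c i j) (p ^ i + p ^ j))"
    using assms(1) unfolding dembowski_ostrom_def by blast
  have "(\<Sum>(i, j)\<in>S. coeff (monom (c i j) (p ^ i + p ^ j)) n) \<noteq> 0"
    using assms(2) unfolding f by (simp add: coeff_sum case_prod_unfold)
  then obtain x where "(case x of (i, j) \<Rightarrow> coeff (monom (c i j) (p ^ i + p ^ j)) n) \<noteq> 0"
    by (meson sum.not_neutral_contains_not_neutral)
  thus ?thesis by (cases x) (auto split: if_splits)
qed

lemma dembowski_ostrom_monom_iff:
  "dembowski_ostrom p (monom (1 :: 'a :: field) n) \<longleftrightarrow> (\<exists>i j. n = p ^ i + p ^ j)"
proof
  assume "dembowski_ostrom p (monom (1 :: 'a) n)"
  thus "\<exists>i j. n = p ^ i + p ^ j" by (rule dembowski_ostrom_exponent) simp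
next
  assume "\<exists>i j. n = p ^ i + p ^ j"
  then obtain i j where "n = p ^ i + p ^ j" by blast
  thus "dembowski_ostrom p (monom (1 :: 'a) n)"
    unfolding dembowski_ostrom_def
    by (intro exI[of _ "{(i, j)}"] exI[of _ "\<lambda>_ _. 1"]) simp
qed

lemma sum_of_two_powers_iff:
  "(\<exists>i j. n = p ^ i + p ^ j) \<longleftrightarrow> (\<exists>\<alpha> s. n = p ^ s * (p ^ \<alpha> + 1))" for n p :: nat
proof
  assume "\<exists>i j. n = p ^ i + p ^ j"
  then obtain i j where "i \<le> j" "n = p ^ i + p ^ j"
    by (metis add.commute nat_le_linear)
  hence "n = p ^ i * (p ^ (j - i) + 1)"
    by (simp add: algebra_simps flip: power_add)
  thus "\<exists>\<alpha> s. n = p ^ s * (p ^ \<alpha> + 1)" by blast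
next
  assume "\<exists>\<alpha> s. n = p ^ s * (p ^ \<alpha> + 1)"
  then obtain \<alpha> s where "n = p ^ (s + \<alpha>) + p ^ s"
    by (auto simp: algebra_simps power_add)
  thus "\<exists>i j. n = p ^ i + p ^ j" by blast
qed

lemma sum_of_two_powers_cong_pred: "[int (p ^ i + p ^ j) = 2] (mod int p - 1)"
proof -
  have 1: "[int p = 1] (mod int p - 1)"
    by (simp add: cong_iff_dvd_diff)
  show ?thesis
    using cong_add[OF cong_pow[OF 1, of i] cong_pow[OF 1, of j]] by simp
qed

text \<open>Since \<open>k d \<equiv> l d \<equiv> 2\<close> modulo \<open>p - 1\<close>, the product \<open>k (k - l) d\<close> is \<open>0\<close> when \<open>(k - l) d\<close> is
  evaluated first and \<open>2 (k - l)\<close> when \<open>k d\<close> is.\<close>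

lemma pred_dvd_if_two_multiples_admissible:
  assumes "k * d = p ^ i + p ^ j" and "l * d = p ^ s + p ^ t"
  shows "int p - 1 dvd 2 * (int k - int l)"
proof -
  have "[int (k * d) = 2] (mod int p - 1)" and "[int (l * d) = 2] (mod int p - 1)"
    unfolding assms by (rule sum_of_two_powers_cong_pred)+
  hence k: "int p - 1 dvd int k * int d - 2" and l: "int p - 1 dvd int l * int d - 2"
    by (simp_all add: cong_iff_dvd_diff)
  have "2 * (int k - int l) =
      int k * ((int k * int d - 2) - (int l * int d - 2)) - (int k - int l) * (int k * int d - 2)"
    by (simp add: algebra_simps)
  also have "int p - 1 dvd \<dots>"
    by (intro dvd_diff[OF dvd_mult[OF dvd_diff[OF k l]] dvd_mult[OF k]])
  finally show ?thesis .
qed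

lemma pcompose_monom_monom:
  "pcompose (monom c n) (monom 1 d) = monom (c :: 'a :: comm_semiring_1) (n * d)"
  by (induction n) (simp_all add: monom_0 monom_Suc pcompose_pCons mult_monom)

lemma dickson_coeff_0: "k > 0 \<Longrightarrow> dickson_coeff k m 0 = 1"
  by (simp add: dickson_coeff_def)

lemma dickson_coeff_1: "k > 1 \<Longrightarrow> dickson_coeff k m 1 = int k - int m"
  by (simp add: dickson_coeff_def)

text \<open>The factor \<open>2\<close> is harmless, as only non-divisibility by \<open>p\<close> will be derived from this, and it
  keeps the formula free of integer division.\<close>

lemma dickson_coeff_2:
  assumes "k > 2"
  shows "2 * dickson_coeff k m 2 = (int k - 2 * int m) * (int k - 3)"
proof -
  have "2 * ((k - 2) choose 2) = (k - 2) * (k - 3)"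
    using times_binomial_minus1_eq[of 2 "k - 2"] by simp
  hence "(2 * of_nat ((k - 2) choose 2) :: rat) = of_nat ((k - 2) * (k - 3))"
    by (metis of_nat_mult of_nat_numeral)
  hence choose: "(of_nat ((k - 2) choose 2) :: rat) = (of_nat k - 2) * (of_nat k - 3) / 2"
    using assms by (simp add: of_nat_diff)
  have "(2 * of_int (dickson_coeff k m 2) :: rat) =
      2 * ((of_nat k - of_nat m * 2) / (of_nat k - 2) * ((of_nat k - 2) * (of_nat k - 3) / 2))"
    using assms by (simp add: dickson_coeff_exact choose)
  also have "\<dots> = of_int ((int k - 2 * int m) * (int k - 3))"
    using assms by simp
  finally show ?thesis by (metis of_int_eq_iff of_int_mult of_int_numeral)
qed

text \<open>For \<open>d > 0\<close> the exponents \<open>(k - 2 i) d\<close> are pairwise distinct, so no coefficients are added up,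
  and \<open>2 i < k\<close> keeps away from the constant term, which is the one removed.\<close>

lemma coeff_dickson_frak:
  assumes "d > 0" and "2 * i < k"
  shows "coeff (dickson_frak d k m a) ((k - 2 * i) * d) = of_int (dickson_coeff k m i) * (- a) ^ i"
proof -
  let ?c = "\<lambda>i. of_int (dickson_coeff k m i) * (- a) ^ i"
  have "coeff (dickson_frak d k m a) ((k - 2 * i) * d) =
      coeff (pcompose (dickson_poly k m a) (monom 1 d)) ((k - 2 * i) * d)"
    using assms unfolding dickson_frak_def by (simp add: coeff_pCons split: nat.split)
  also have "\<dots> = (\<Sum>i' = 0..k div 2. coeff (monom (?c i') ((k - 2 * i') * d)) ((k - 2 * i) * d))"
    by (simp only: dickson_poly_def pcompose_sum pcompose_monom_monom coeff_sum)
  also have "\<dots> = (\<Sum>i' = 0..k div 2. if i' = i then ?c i' else 0)"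
    using assms by (intro sum.cong) auto
  also have "\<dots> = ?c i"
    using assms by simp
  finally show ?thesis .
qed

lemma dickson_frak_small:
  assumes "k = 1 \<or> k = 2" and "d > 0"
  shows "dickson_frak d k m a = monom 1 (k * d)"
proof -
  have "dickson_coeff k m 0 = 1"
    using assms by (auto intro: dickson_coeff_0)
  hence "\<exists>c. dickson_poly k m a = monom 1 k + [:c:]"
    using assms(1) by (auto simp: dickson_poly_def monom_0 intro: exI[of _ 0])
  then obtain c where c: "dickson_poly k m a = monom 1 k + [:c:]" ..
  show ?thesis
    using assms unfolding dickson_frak_def c
    by (auto simp: pcompose_add pcompose_monom_monom poly_monom)
qed

lemma of_int_eq_0_iff_prime_dvd:
  fixes p r :: nat
  assumes "prime p" and "CARD('a :: {field, finite}) = p ^ r"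
  shows "of_int z = (0 :: 'a) \<longleftrightarrow> int p dvd z"
proof -
  have "prime CHAR('a)"
    by (intro prime_CHAR_semidom finite_imp_CHAR_pos) simp
  moreover have "CHAR('a) dvd p ^ r"
  proof -
    \<comment> \<open>Translation by \<open>1\<close> permutes the field, so it leaves the sum of all elements unchanged.\<close>
    have "(\<Sum>x \<in> (UNIV :: 'a set). x + 1) = (\<Sum>x \<in> UNIV. x)"
      by (rule sum.reindex_bij_witness[of _ "\<lambda>x. x - 1" "\<lambda>x. x + 1"]) auto
    hence "of_nat CARD('a) = (0 :: 'a)" by (simp add: sum.distrib)
    thus ?thesis by (simp only: of_nat_eq_0_iff_char_dvd assms(2))
  qed
  ultimately have "CHAR('a) = p"
    using assms(1) by (metis prime_dvd_power primes_dvd_imp_eq)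
  thus ?thesis by (simp add: of_int_eq_0_iff_char_dvd)
qed

text \<open>Two exponents at distance \<open>2 d\<close> or \<open>4 d\<close>, one of them the leading \<open>k d\<close>, are incompatible with
  admissibility. If \<open>k \<equiv> m\<close>, the residues \<open>0\<close> and \<open>3\<close> would kill the coefficient of \<open>X\<^bsup>(k - 4)d\<^esup>\<close>,
  and the residues \<open>3\<close> and \<open>4\<close> would allow \<open>k \<le> 4\<close>, where this power does not occur.\<close>

lemma not_dembowski_ostrom_dickson_frak:
  fixes a :: "'a :: {field, finite}" and p r m k d :: nat
  assumes p: "prime p" "p > 5" and card: "CARD('a) = p ^ r" and a: "a \<noteq> 0"
    and m: "m mod p \<notin> {0, 3, 4}" and k: "k \<ge> 3" and d: "d > 0"
  shows "\<not> dembowski_ostrom p (dickson_frak d k m a)"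
proof
  assume DO: "dembowski_ostrom p (dickson_frak d k m a)"
  have exponent: "\<exists>s t. (k - 2 * i) * d = p ^ s + p ^ t"
    if "2 * i < k" and "\<not> int p dvd dickson_coeff k m i" for i
    using that a d coeff_dickson_frak[of d i k m a] of_int_eq_0_iff_prime_dvd[OF p(1) card]
    by (intro dembowski_ostrom_exponent[OF DO]) simp
  obtain s t where lead: "k * d = p ^ s + p ^ t"
    using exponent[of 0] k p by (auto simp: dickson_coeff_0)
  \<comment> \<open>The only divisor of \<open>8\<close> exceeding \<open>4\<close> is \<open>8\<close> itself, and \<open>9\<close> is not prime. This serves both
    choices of the second exponent, since \<open>4\<close> divides \<open>8\<close>.\<close>
  have not_dvd: "\<not> int p - 1 dvd 8"
  proof
    assume "int p - 1 dvd 8"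
    hence "int p - 1 \<le> 8" by (intro zdvd_imp_le) auto
    hence "p \<in> {6, 7, 8, 9}" using p(2) by auto
    moreover have "\<not> prime (9 :: nat)"
      by (auto simp: prime_nat_iff intro!: exI[of _ 3])
    ultimately show False using \<open>int p - 1 dvd 8\<close> p(1) by auto
  qed
  show False
  proof (cases "int p dvd int k - int m")
    case False
    then obtain s' t' where "(k - 2) * d = p ^ s' + p ^ t'"
      using exponent[of 1] dickson_coeff_1[of k m] k by auto
    from pred_dvd_if_two_multiples_admissible[OF lead this] k
    have "int p - 1 dvd 4" by (simp add: of_nat_diff)
    hence "int p - 1 dvd 4 * 2" by (rule dvd_mult2)
    thus False using not_dvd by simp
  next
    case True
    hence "[k = m] (mod p)"
      by (simp add: cong_iff_dvd_diff flip: cong_int_iff)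
    hence k_mod: "k mod p \<notin> {0, 3, 4}"
      using m by (simp add: cong_def)
    hence "k \<noteq> 3" "k \<noteq> 4" using p(2) by auto
    hence k5: "k \<ge> 5" using k by simp
    have "\<not> int p dvd int k"
      using k_mod by auto
    moreover have "\<not> int p dvd int k - 3"
    proof
      assume "int p dvd int k - 3"
      hence "[k = 3] (mod p)"
        by (simp add: cong_iff_dvd_diff flip: cong_int_iff)
      thus False using k_mod p(2) by (simp add: cong_def)
    qed
    moreover have "prime (int p)" using p(1) by simp
    ultimately have "\<not> int p dvd int k * (int k - 3)"
      by (simp add: prime_dvd_mult_iff)
    \<comment> \<open>Replacing \<open>m\<close> by \<open>k\<close> turns \<open>(k - 2 m) (k - 3)\<close> into \<open>- k (k - 3)\<close>.\<close>
    moreover have "int k * (int k - 3) =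
        2 * (int k - 3) * (int k - int m) - 2 * dickson_coeff k m 2"
      using k5 by (simp add: dickson_coeff_2 algebra_simps)
    ultimately have "\<not> int p dvd dickson_coeff k m 2"
      using True by (metis dvd_diff dvd_mult)
    then obtain s' t' where "(k - 4) * d = p ^ s' + p ^ t'"
      using exponent[of 2] k5 by auto
    from pred_dvd_if_two_multiples_admissible[OF lead this] k5
    have "int p - 1 dvd 8" by (simp add: of_nat_diff)
    thus False using not_dvd by simp
  qed
qed

theorem theorem5p1:
  fixes a :: "'a :: {field, finite}" and p q r m k d :: nat
  assumes "prime p" and "p > 5"
    and "q = p ^ r" and "r \<ge> 1"
    and "CARD('a) = q"
    and "a \<noteq> 0"
    and "m mod p \<notin> {0, 1, 2, 3, 4}"
    and "k > 0" and "d > 0"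
  shows "dembowski_ostrom p (dickson_frak d k m a) \<longleftrightarrow>
      (k = 1 \<and> (\<exists>\<alpha> n :: nat. d = p ^ n * (p ^ \<alpha> + 1))) \<or>
      (k = 2 \<and> (\<exists>\<alpha> n :: nat. real d = real (p ^ n * (p ^ \<alpha> + 1)) / 2))"
proof (cases "k \<ge> 3")
  case True
  thus ?thesis
    using not_dembowski_ostrom_dickson_frak[of p r a m k d] assms by auto
next
  case False
  have half: "real d = real n / 2 \<longleftrightarrow> 2 * d = n" for n
    by linarith
  from False have k: "k = 1 \<or> k = 2" using \<open>k > 0\<close> by auto
  hence "dembowski_ostrom p (dickson_frak d k m a) \<longleftrightarrow>
      (\<exists>\<alpha> n. k * d = p ^ n * (p ^ \<alpha> + 1))"
    using \<open>d > 0\<close> by (simp only: dickson_frak_small dembowski_ostrom_monom_iff sum_of_two_powers_iff)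
  thus ?thesis
    unfolding half using k by (elim disjE) simp_all
qed

end
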